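(* Let $n,r\ge 1$ be integers and let $A, B_1,\dots,B_n, C_1,\dots,C_n$ be matrices in $\mathbb{C}^{r\times r}$ such that $C_i+kI$ is invertible for all $1\le i\le n$ and all integers $k\ge 0$, and such that $B_iB_j=B_jB_i$, $C_iB_j=B_jC_i$ and $C_iC_j=C_jC_i$ for all $i,j=1,\dots,n$. Then the matrix function $U=F_{\mathcal{A}}[A,B_1,\dots,B_n;C_1,\dots,C_n;x_1,\dots,x_n]$ satisfies, on the interior of the region of absolute convergence of its defining series, the system of partial matrix differential equations $$x_i(1-x_i)\,U_{x_ix_i}-\sum_{\substack{j=1\\ j\ne i}}^{n} x_ix_j\,U_{x_ix_j}-x_i(A+I)U_{x_i}-\Big(\sum_{j=1}^{n}x_jU_{x_j}\Big)B_i+U_{x_i}C_i-A\,U\,B_i=0,\qquad i=1,\dots,n.$$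
   Context: For $M\in\mathbb{C}^{r\times r}$, the Pochhammer symbol is $(M)_0=I$ and $(M)_k=M(M+I)\cdots(M+(k-1)I)$ for $k\ge1$; $(M)_k^{-1}$ denotes the inverse matrix of $(M)_k$. Matrix products are taken in the written order. For complex variables $x_1,\dots,x_n$, $$F_{\mathcal{A}}[A,B_1,\dots,B_n;C_1,\dots,C_n;x_1,\dots,x_n]=\sum_{m_1,\dots,m_n=0}^{\infty}(A)_{m_1+\cdots+m_n}(B_1)_{m_1}\cdots(B_n)_{m_n}(C_1)_{m_1}^{-1}\cdots(C_n)_{m_n}^{-1}\,\frac{x_1^{m_1}\cdots x_n^{m_n}}{m_1!\cdots m_n!}.$$ Subscripts denote partial derivatives: $U_{x_i}=\partial U/\partial x_i$, $U_{x_ix_j}=\partial^2U/\partial x_i\partial x_j$. *)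

theory Defs
  imports "HOL-Analysis.Analysis"
begin

text \<open>
  The variables \<open>x\<^sub>1, \<dots>, x\<^sub>n\<close> are indexed by a type \<open>'n\<close> that is finite and linearly ordered; the
  order is used only for the ordered matrix product below. Note that \<open>*\<close> on \<open>complex ^ 'r ^ 'r\<close> is the
  componentwise product; the matrix product is \<open>**\<close>, and \<open>mat c\<close> is the scalar matrix \<open>c I\<close>.
\<close>

definition mscale :: "complex \<Rightarrow> complex ^ 'r ^ 'r \<Rightarrow> complex ^ 'r ^ 'r"  (infixr "*\<^sub>m" 75) where
  "c *\<^sub>m M = (\<chi> a b. c * M $ a $ b)"

primrec mpochhammer :: "complex ^ 'r ^ 'r \<Rightarrow> nat \<Rightarrow> complex ^ 'r ^ 'r" where
  "mpochhammer M 0 = mat 1"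
| "mpochhammer M (Suc k) = mpochhammer M k ** (M + mat (of_nat k))"

definition ordered_mprod ::
    "('n::{finite, linorder} \<Rightarrow> complex ^ 'r ^ 'r) \<Rightarrow> complex ^ 'r ^ 'r" where
  "ordered_mprod G = foldr (\<lambda>i P. G i ** P) (sorted_list_of_set UNIV) (mat 1)"

definition FA_term ::
    "complex ^ 'r ^ 'r \<Rightarrow> ('n::{finite, linorder} \<Rightarrow> complex ^ 'r ^ 'r) \<Rightarrow> ('n \<Rightarrow> complex ^ 'r ^ 'r) \<Rightarrow>
     (complex, 'n) vec \<Rightarrow> ('n \<Rightarrow> nat) \<Rightarrow> complex ^ 'r ^ 'r" where
  "FA_term A B C x m =
     (\<Prod>i\<in>UNIV. x $ i ^ m i / fact (m i)) *\<^sub>m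
       (mpochhammer A (\<Sum>i\<in>UNIV. m i)
         ** ordered_mprod (\<lambda>i. mpochhammer (B i) (m i))
         ** ordered_mprod (\<lambda>i. matrix_inv (mpochhammer (C i) (m i))))"

text \<open>Outside the region of summability, \<open>infsum\<close> gives the junk value 0.\<close>

definition FA ::
    "complex ^ 'r ^ 'r \<Rightarrow> ('n::{finite, linorder} \<Rightarrow> complex ^ 'r ^ 'r) \<Rightarrow> ('n \<Rightarrow> complex ^ 'r ^ 'r) \<Rightarrow>
     (complex, 'n) vec \<Rightarrow> complex ^ 'r ^ 'r" where
  "FA A B C x = (\<Sum>\<^sub>\<infinity>m\<in>UNIV. FA_term A B C x m)"

definition FA_abs_conv_region ::
    "complex ^ 'r ^ 'r \<Rightarrow> ('n::{finite, linorder} \<Rightarrow> complex ^ 'r ^ 'r) \<Rightarrow> ('n \<Rightarrow> complex ^ 'r ^ 'r) \<Rightarrow>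
     (complex, 'n) vec set" where
  "FA_abs_conv_region A B C = {x. (\<lambda>m. norm (FA_term A B C x m)) summable_on UNIV}"

definition set_coord :: "complex ^ 'n \<Rightarrow> 'n \<Rightarrow> complex \<Rightarrow> complex ^ 'n" where
  "set_coord x i t = (\<chi> j. if j = i then t else x $ j)"

text \<open>Complex partial derivatives of matrix-valued functions are taken entrywise. Since \<open>deriv\<close> is
  total, existence of the derivative is a separate predicate.\<close>

definition partially_differentiable ::
    "(complex ^ 'n \<Rightarrow> complex ^ 'r ^ 'r) \<Rightarrow> 'n \<Rightarrow> complex ^ 'n \<Rightarrow> bool" where
  "partially_differentiable U i x \<longleftrightarrow>
     (\<forall>a b. (\<lambda>t. U (set_coord x i t) $ a $ b) field_differentiable (at (x $ i)))"

definition partial_deriv ::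
    "'n \<Rightarrow> (complex ^ 'n \<Rightarrow> complex ^ 'r ^ 'r) \<Rightarrow> complex ^ 'n \<Rightarrow> complex ^ 'r ^ 'r" where
  "partial_deriv i U x = (\<chi> a b. deriv (\<lambda>t. U (set_coord x i t) $ a $ b) (x $ i))"

definition partial_deriv2 ::
    "'n \<Rightarrow> 'n \<Rightarrow> (complex ^ 'n \<Rightarrow> complex ^ 'r ^ 'r) \<Rightarrow> complex ^ 'n \<Rightarrow> complex ^ 'r ^ 'r" where
  "partial_deriv2 i j U = partial_deriv i (partial_deriv j U)"

end

theory Submission
  imports Defs "HOL-Complex_Analysis.Cauchy_Integral_Formula"
begin

text \<open>
  Write \<open>U(x) = \<Sum> K(m) x\<^sup>m\<close> over multi-indices \<open>m\<close>. Since the first parameter stands on the left and every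
  \<open>B\<^sub>i\<close>, \<open>C\<^sub>i\<close> commutes with every other, raising \<open>m\<^sub>i\<close> by one gives the first-order recurrence
  \<open>(m\<^sub>i + 1) K(m + e\<^sub>i) (C\<^sub>i + m\<^sub>i I) = (A + |m| I) K(m) (B\<^sub>i + m\<^sub>i I)\<close>
  (\<open>FA_coeff_recurrence\<close>). The factor \<open>A + |m| I\<close> can be pulled out on the left because it commutes
  with the Pochhammer symbol of \<open>A\<close>; nothing relates \<open>A\<close> to the other parameters, which is why in the
  differential equation \<open>A\<close> multiplies from the left and \<open>B\<^sub>i\<close>, \<open>C\<^sub>i\<close> from the right.

  The operator \<open>x\<^sub>i \<partial>\<^sub>i\<close> multiplies the coefficient at \<open>m\<close> by \<open>m\<^sub>i\<close>, and \<open>\<partial>\<^sub>i\<close> replaces it by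
  \<open>(m\<^sub>i + 1) K(m + e\<^sub>i)\<close>. Substituted into the left-hand side of the equation, this turns the coefficient at
  \<open>m\<close> into the difference of the two sides of the recurrence (\<open>coefficient_identity\<close>), so the
  left-hand side is a power series with zero coefficients.

  It remains to differentiate the series termwise. The absolute value of each term depends only on the
  moduli of the coordinates and grows with them. Hence an interior point of the region of absolute
  convergence lies in an open polydisc on which the series converges
  (\<open>FA_series_on_polydisc\<close>): push all moduli up slightly. On a polydisc, the finite partial
  sums converge locally uniformly in each single variable, so by Weierstrass' theorem their derivatives
  converge to the derivative of the sum (\<open>power_series_has_partial_derivative\<close>). As this holds on the
  whole of the same polydisc, the derivative is again the sum of a power series there, and the step can
  be repeated for second derivatives.
\<close>

section \<open>Algebra of square matrices\<close>

lemma mscale_nth [simp]: "(c *\<^sub>m M) $ a $ b = c * M $ a $ b"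
  by (simp add: mscale_def)

lemma mscale_simps [simp]:
  "1 *\<^sub>m M = M" "0 *\<^sub>m M = 0" "c *\<^sub>m (0 :: complex ^ 'r ^ 'r) = 0"
  by (simp_all add: vec_eq_iff)

lemma mscale_mscale: "c *\<^sub>m d *\<^sub>m M = (c * d) *\<^sub>m M"
  by (simp add: vec_eq_iff)

lemma mscale_add_right: "c *\<^sub>m (M + N) = c *\<^sub>m M + c *\<^sub>m N"
  by (simp add: vec_eq_iff algebra_simps)

lemma mscale_sum_left: "(\<Sum>j\<in>J. f j) *\<^sub>m M = (\<Sum>j\<in>J. f j *\<^sub>m M)"
  by (simp add: vec_eq_iff sum_distrib_right)

lemma mscale_mult_left: "(c *\<^sub>m M) ** N = c *\<^sub>m (M ** N)"
  by (simp add: vec_eq_iff matrix_matrix_mult_def sum_distrib_left mult.assoc)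

lemma mscale_mult_right: "M ** (c *\<^sub>m N) = c *\<^sub>m (M ** N)"
  by (simp add: vec_eq_iff matrix_matrix_mult_def sum_distrib_left mult_ac)

lemma mat_mult_left: "mat c ** M = c *\<^sub>m M"
  by (simp add: vec_eq_iff matrix_matrix_mult_def mat_def if_distrib if_distribR cong: if_cong)

lemma mat_mult_right: "M ** mat c = c *\<^sub>m M"
  by (simp add: vec_eq_iff matrix_matrix_mult_def mat_def if_distrib if_distribR mult.commute cong: if_cong)

lemma matrix_add_rdistrib: "(M + N) ** P = M ** P + N ** (P :: complex ^ 'r ^ 'r)"
  by (simp add: vec_eq_iff matrix_matrix_mult_def algebra_simps sum.distrib)

lemma linear_matrix_mult_left: "linear (\<lambda>M. P ** (M :: complex ^ 'r ^ 'r))"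
  by (rule linearI)
     (simp_all add: vec_eq_iff matrix_matrix_mult_def algebra_simps sum.distrib scaleR_sum_right)

lemma linear_matrix_mult_right: "linear (\<lambda>M. (M :: complex ^ 'r ^ 'r) ** P)"
  by (rule linearI)
     (simp_all add: vec_eq_iff matrix_matrix_mult_def algebra_simps sum.distrib scaleR_sum_right)

lemma norm_mscale: "norm (c *\<^sub>m M) = norm c * norm M"
  by (simp add: norm_vec_def L2_set_right_distrib mscale_def norm_mult)

definition commutes :: "complex ^ 'r ^ 'r \<Rightarrow> complex ^ 'r ^ 'r \<Rightarrow> bool" where
  "commutes X Y \<longleftrightarrow> X ** Y = Y ** X"

lemma commutes_sym: "commutes X Y \<Longrightarrow> commutes Y X"
  by (simp add: commutes_def)

lemma commutes_mat: "commutes X (mat c)"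
  by (simp add: commutes_def mat_mult_left mat_mult_right)

lemma commutes_add: "commutes X Y \<Longrightarrow> commutes X Z \<Longrightarrow> commutes X (Y + Z)"
  by (simp add: commutes_def matrix_add_ldistrib matrix_add_rdistrib)

lemma commutes_shifted: "commutes X Y \<Longrightarrow> commutes (X + mat c) Y"
  by (rule commutes_sym[OF commutes_add[OF commutes_sym commutes_mat]])

lemma commutes_mult: "commutes X Y \<Longrightarrow> commutes X Z \<Longrightarrow> commutes X (Y ** Z)"
  by (metis commutes_def matrix_mul_assoc)

lemma commutes_mpochhammer: "commutes X M \<Longrightarrow> commutes X (mpochhammer M k)"
  by (induction k) (auto intro!: commutes_mult commutes_add commutes_mat)

lemma invertible_mpochhammer:
  assumes "\<And>k. invertible (M + mat (of_nat k))"
  shows "invertible (mpochhammer M k)"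
proof (induction k)
  case 0
  have "invertible (mat 1 :: complex ^ 'a ^ 'a)"
    unfolding invertible_def by (rule exI[of _ "mat 1"]) simp
  thus ?case by simp
next
  case (Suc k)
  thus ?case using assms by (simp add: invertible_mult)
qed

lemma matrix_inv_inverse:
  fixes M :: "complex ^ 'r ^ 'r"
  assumes "invertible M"
  shows "M ** matrix_inv M = mat 1" "matrix_inv M ** M = mat 1"
proof -
  have "M ** matrix_inv M = mat 1 \<and> matrix_inv M ** M = mat 1"
    unfolding matrix_inv_def by (rule someI_ex) (use assms in \<open>simp add: invertible_def\<close>)
  thus "M ** matrix_inv M = mat 1" "matrix_inv M ** M = mat 1" by auto
qed

lemma commutes_matrix_inv:
  assumes "invertible M" "commutes X M"
  shows "commutes X (matrix_inv M)"
proof -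
  have "matrix_inv M ** (M ** X) ** matrix_inv M = matrix_inv M ** (X ** M) ** matrix_inv M"
    using assms(2) by (simp add: commutes_def)
  hence "(matrix_inv M ** M) ** X ** matrix_inv M = matrix_inv M ** X ** (M ** matrix_inv M)"
    by (simp add: matrix_mul_assoc)
  thus ?thesis
    using matrix_inv_inverse[OF assms(1)] by (simp add: commutes_def)
qed

lemma matrix_inv_mult_cancel:
  fixes M N :: "complex ^ 'r ^ 'r"
  assumes "invertible M" "invertible N"
  shows "matrix_inv (M ** N) ** M = matrix_inv N"
proof -
  have "matrix_inv (M ** N) ** M ** (N ** matrix_inv N) = matrix_inv N"
    using matrix_inv_inverse(2)[OF invertible_mult[OF assms]] by (simp add: matrix_mul_assoc)
  thus ?thesis
    using matrix_inv_inverse(1)[OF assms(2)] by simp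
qed

section \<open>Ordered products of commuting matrices\<close>

lemma commutes_ordered_mprod:
  assumes "\<And>j. commutes X (G j)"
  shows "commutes X (ordered_mprod G)"
proof -
  have "commutes X (foldr (\<lambda>i P. G i ** P) js (mat 1))" for js
    by (induction js) (auto intro: commutes_mult assms commutes_mat)
  thus ?thesis by (simp add: ordered_mprod_def)
qed

text \<open>
  \<open>X\<close> commutes with every factor after position \<open>i\<close>, so it travels past them to the right end.
\<close>

lemma ordered_mprod_upd:
  fixes G :: "'n::{finite,linorder} \<Rightarrow> complex ^ 'r ^ 'r"
  assumes "\<And>j. commutes X (G j)"
  shows "ordered_mprod (G(i := G i ** X)) = ordered_mprod G ** X"
proof -
  let ?f = "\<lambda>G js. foldr (\<lambda>i P. G i ** P) js (mat 1 :: complex ^ 'r ^ 'r)"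
  have comm: "commutes X (?f G js)" for js
    by (induction js) (auto intro: commutes_mult assms commutes_mat)
  have "?f (G(i := G i ** X)) js = (if i \<in> set js then ?f G js ** X else ?f G js)"
    if "distinct js" for js
    using that
  proof (induction js)
    case (Cons j js)
    thus ?case
      using comm[of js] by (auto simp: commutes_def matrix_mul_assoc[symmetric])
  qed simp
  thus ?thesis by (simp add: ordered_mprod_def)
qed

section \<open>Matrix power series in several variables\<close>

definition monomial :: "complex ^ 'n \<Rightarrow> ('n \<Rightarrow> nat) \<Rightarrow> complex" where
  "monomial z m = (\<Prod>i\<in>UNIV. z $ i ^ m i)"

text \<open>
  The sum is over multi-indices as an unordered family, so a sum is a limit along the filter of finite sets of
  multi-indices, and the theorem on limits of holomorphic functions applies along that filter.
\<close>

definition msums :: "(('n \<Rightarrow> nat) \<Rightarrow> complex ^ 'r ^ 'r) \<Rightarrow> complex ^ 'n \<Rightarrow> complex ^ 'r ^ 'r \<Rightarrow> bool" where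
  "msums c z S \<longleftrightarrow> ((\<lambda>m. monomial z m *\<^sub>m c m) has_sum S) UNIV"

abbreviation shift :: "'n \<Rightarrow> ('n \<Rightarrow> nat) \<Rightarrow> 'n \<Rightarrow> nat" where
  "shift i m \<equiv> m(i := Suc (m i))"

lemma monomial_split:
  "monomial (z :: complex ^ 'n) m = z $ i ^ m i * (\<Prod>j\<in>UNIV - {i}. z $ j ^ m j)"
  unfolding monomial_def by (subst prod.remove[of UNIV i]) auto

lemma monomial_shift: "monomial z (shift i m) = z $ i * monomial z m"
  by (simp add: monomial_split[of z _ i] mult.assoc)

lemma monomial_set_coord:
  "monomial (set_coord z i t) m = t ^ m i * (\<Prod>j\<in>UNIV - {i}. z $ j ^ m j)"
  by (simp add: monomial_split[of _ _ i] set_coord_def)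

lemma norm_monomial_mono:
  assumes "\<And>j. norm (z $ j) \<le> norm (w $ j)"
  shows "norm (monomial z m) \<le> norm (monomial w m)"
  by (auto simp: monomial_def prod_norm[symmetric] norm_power intro!: prod_mono power_mono assms)

lemma inj_shift: "inj (shift i)"
proof (rule injI)
  fix m m' :: "'a \<Rightarrow> nat" assume eq: "shift i m = shift i m'"
  have "m j = m' j" for j
    using fun_cong[OF eq, of j] by (auto split: if_splits)
  thus "m = m'" by auto
qed

text \<open>
  The multi-indices with \<open>m\<^sub>i > 0\<close> are exactly those of the form \<open>m' + e\<^sub>i\<close>.
\<close>

lemma has_sum_shift:
  fixes f :: "('n \<Rightarrow> nat) \<Rightarrow> 'a :: {comm_monoid_add, topological_space}"
  assumes "\<And>m. m i = 0 \<Longrightarrow> f m = 0"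
  shows "((\<lambda>m. f (shift i m)) has_sum S) UNIV \<longleftrightarrow> (f has_sum S) UNIV"
proof -
  have "m \<in> range (shift i)" if "m i \<noteq> 0" for m
    using that by (intro image_eqI[of _ _ "m(i := m i - 1)"]) auto
  hence "(f has_sum S) UNIV \<longleftrightarrow> (f has_sum S) (range (shift i))"
    by (intro has_sum_cong_neutral) (use assms in blast)+
  also have "\<dots> \<longleftrightarrow> ((\<lambda>m. f (shift i m)) has_sum S) UNIV"
    by (subst has_sum_reindex[OF inj_shift]) (simp add: o_def)
  finally show ?thesis ..
qed

lemma linear_mscale: "linear (\<lambda>M :: complex ^ 'r ^ 'r. c *\<^sub>m M)"
  by (rule linearI) (auto simp: vec_eq_iff algebra_simps scaleR_conv_of_real)

lemma msums_linear:
  assumes "linear h" "\<And>c M. h (c *\<^sub>m M) = c *\<^sub>m h M" "msums c z S"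
  shows "msums (\<lambda>m. h (c m)) z (h S)"
  using has_sum_bounded_linear[of h "\<lambda>m. monomial z m *\<^sub>m c m" UNIV S] assms
  by (simp add: msums_def linear_conv_bounded_linear)

lemma msums_mult_left: "msums c z S \<Longrightarrow> msums (\<lambda>m. M ** c m) z (M ** S)"
  by (rule msums_linear[OF linear_matrix_mult_left]) (simp_all add: mscale_mult_right)

lemma msums_mult_right: "msums c z S \<Longrightarrow> msums (\<lambda>m. c m ** M) z (S ** M)"
  by (rule msums_linear[OF linear_matrix_mult_right]) (simp_all add: mscale_mult_left)

lemma msums_add: "msums c z S \<Longrightarrow> msums d z T \<Longrightarrow> msums (\<lambda>m. c m + d m) z (S + T)"
  unfolding msums_def mscale_add_right by (rule has_sum_add)

lemma msums_diff:
  assumes "msums c z S" "msums d z T"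
  shows "msums (\<lambda>m. c m - d m) z (S - T)"
proof -
  have "msums (\<lambda>m. - d m) z (- T)"
    by (rule msums_linear[OF _ _ assms(2)]) (auto intro!: linearI simp: vec_eq_iff)
  from msums_add[OF assms(1) this] show ?thesis by simp
qed

lemma msums_zero: "msums (\<lambda>m. 0) z 0"
  by (simp add: msums_def)

lemma msums_sum:
  "finite J \<Longrightarrow> (\<And>j. j \<in> J \<Longrightarrow> msums (c j) z (S j)) \<Longrightarrow> msums (\<lambda>m. \<Sum>j\<in>J. c j m) z (\<Sum>j\<in>J. S j)"
  by (induction J rule: finite_induct) (auto intro!: msums_add simp: msums_zero)

text \<open>
  Multiplication by \<open>z\<^sub>i\<close> raises the exponent of \<open>z\<^sub>i\<close>, so it undoes a shift of the coefficients as long as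
  no coefficient with \<open>m\<^sub>i = 0\<close> is lost.
\<close>

lemma msums_coord_mult:
  assumes "msums (\<lambda>m. c (shift i m)) z S" "\<And>m. m i = 0 \<Longrightarrow> c m = 0"
  shows "msums c z (z $ i *\<^sub>m S)"
proof -
  have "((\<lambda>m. z $ i *\<^sub>m monomial z m *\<^sub>m c (shift i m)) has_sum (z $ i *\<^sub>m S)) UNIV"
    using has_sum_bounded_linear[OF linear_mscale[unfolded linear_conv_bounded_linear]]
      assms(1)[unfolded msums_def] by fast
  hence "((\<lambda>m. monomial z (shift i m) *\<^sub>m c (shift i m)) has_sum (z $ i *\<^sub>m S)) UNIV"
    by (simp add: monomial_shift mscale_mscale)
  thus ?thesis
    unfolding msums_def by (subst (asm) has_sum_shift) (use assms(2) in auto)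
qed

lemma msums_unique: "msums c z S \<Longrightarrow> msums c z T \<Longrightarrow> S = T"
  unfolding msums_def by (rule has_sum_unique)

text \<open>
  Partial derivatives are entrywise, so termwise differentiation is a scalar question.
\<close>

lemma msums_entrywise:
  "msums c z S \<longleftrightarrow> (\<forall>a b. ((\<lambda>m. monomial z m * c m $ a $ b) has_sum S $ a $ b) UNIV)"
proof
  assume S: "msums c z S"
  show "\<forall>a b. ((\<lambda>m. monomial z m * c m $ a $ b) has_sum S $ a $ b) UNIV"
  proof (intro allI)
    fix a b
    show "((\<lambda>m. monomial z m * c m $ a $ b) has_sum S $ a $ b) UNIV"
      using tendsto_vec_nth[OF tendsto_vec_nth[OF S[unfolded msums_def has_sum_def], of a], of b]
      by (simp add: has_sum_def)
  qed
next
  assume "\<forall>a b. ((\<lambda>m. monomial z m * c m $ a $ b) has_sum S $ a $ b) UNIV"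
  thus "msums c z S"
    unfolding msums_def has_sum_def by (intro vec_tendstoI) simp
qed

section \<open>Termwise differentiation\<close>

definition polydisc :: "('n \<Rightarrow> real) \<Rightarrow> (complex ^ 'n) set" where
  "polydisc R = {z. \<forall>j. norm (z $ j) < R j}"

text \<open>
  Along a small closed disc around \<open>x\<^sub>i\<close> in the \<open>i\<close>-th variable, the terms are dominated by their moduli at
  the point of the polydisc whose \<open>i\<close>-th coordinate is \<open>|x\<^sub>i| + r\<close>. The M-test makes the
  partial sums converge uniformly on this disc, and a uniform limit of holomorphic functions can be
  differentiated under the limit; in particular the series of derivatives converges without any separate
  estimate. Reindexing by \<open>m \<mapsto> m + e\<^sub>i\<close> then brings it back to power series form.
\<close>

lemma power_series_has_partial_derivative:
  fixes c :: "('n::finite \<Rightarrow> nat) \<Rightarrow> complex"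
  assumes F: "\<And>z. z \<in> polydisc R \<Longrightarrow> ((\<lambda>m. monomial z m * c m) has_sum F z) UNIV"
    and x: "x \<in> polydisc R"
  obtains D where "((\<lambda>t. F (set_coord x i t)) has_field_derivative D) (at (x $ i))"
    and "((\<lambda>m. monomial x m * (of_nat (Suc (m i)) * c (shift i m))) has_sum D) UNIV"
proof -
  define r where "r = (R i - norm (x $ i)) / 2"
  have r: "r > 0" "norm (x $ i) + r < R i"
    using x by (auto simp: r_def polydisc_def field_simps)
  define \<rho> where "\<rho> = norm (x $ i) + r"
  have \<rho>: "\<rho> > 0" unfolding \<rho>_def using r(1) by (smt (verit) norm_ge_zero)
  have pd: "set_coord x i t \<in> polydisc R" if "norm t \<le> \<rho>" for t
    using that x r by (auto simp: polydisc_def set_coord_def \<rho>_def)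
  have t_le: "norm t \<le> \<rho>" if "t \<in> cball (x $ i) r" for t
    using that norm_triangle_ineq2[of t "x $ i"] by (auto simp: \<rho>_def dist_norm norm_minus_commute)
  define Q where "Q m = (\<Prod>j\<in>UNIV - {i}. x $ j ^ m j)" for m
  let ?term = "\<lambda>m t. t ^ m i * Q m * c m"
  let ?term' = "\<lambda>m t. of_nat (m i) * t ^ (m i - 1) * Q m * c m"
  have mono: "monomial (set_coord x i t) m * c m = ?term m t" for t m
    by (simp add: monomial_set_coord Q_def)
  have "(\<lambda>m. ?term m (of_real \<rho>)) summable_on UNIV"
    using F[OF pd[of "of_real \<rho>"]] \<rho> unfolding mono by (auto simp: summable_on_def)
  hence summ: "(\<lambda>m. norm (?term m (of_real \<rho>))) summable_on UNIV"
    by (simp only: summable_on_iff_abs_summable_on_complex)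
  have ulim: "uniform_limit (cball (x $ i) r) (\<lambda>X t. \<Sum>m\<in>X. ?term m t)
      (\<lambda>t. F (set_coord x i t)) (finite_subsets_at_top UNIV)"
  proof (rule Weierstrass_m_test_general'[OF _ _ summ])
    fix m t assume "t \<in> cball (x $ i) r"
    from t_le[OF this] show "norm (?term m t) \<le> norm (?term m (of_real \<rho>))"
      using \<rho> by (auto simp: norm_mult norm_power intro!: mult_right_mono power_mono)
  next
    fix t assume "t \<in> cball (x $ i) r"
    from F[OF pd[OF t_le[OF this]]]
    show "((\<lambda>m. ?term m t) has_sum F (set_coord x i t)) UNIV" unfolding mono .
  qed
  obtain g' where g': "\<And>w. w \<in> ball (x $ i) r \<Longrightarrow>
      ((\<lambda>t. F (set_coord x i t)) has_field_derivative g' w) (at w) \<and>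
      ((\<lambda>X. \<Sum>m\<in>X. ?term' m w) \<longlongrightarrow> g' w) (finite_subsets_at_top UNIV)"
  proof (rule has_complex_derivative_uniform_limit[OF _ ulim _ r(1)])
    show "\<forall>\<^sub>F X in finite_subsets_at_top UNIV.
        continuous_on (cball (x $ i) r) (\<lambda>t. \<Sum>m\<in>X. ?term m t) \<and>
        (\<forall>w\<in>ball (x $ i) r. ((\<lambda>t. \<Sum>m\<in>X. ?term m t) has_field_derivative (\<Sum>m\<in>X. ?term' m w)) (at w))"
      by (intro always_eventually allI conjI ballI)
         (auto intro!: continuous_intros derivative_eq_intros sum.cong simp: mult_ac)
  qed auto
  have D: "((\<lambda>m. ?term' m (x $ i)) has_sum g' (x $ i)) UNIV"
    using g'[of "x $ i"] r(1) by (simp add: has_sum_def)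
  have "((\<lambda>m. ?term' (shift i m) (x $ i)) has_sum g' (x $ i)) UNIV"
    by (subst has_sum_shift) (use D in auto)
  moreover have "Q (shift i m) = Q m" for m
    by (auto simp: Q_def intro!: prod.cong)
  hence "?term' (shift i m) (x $ i) = monomial x m * (of_nat (Suc (m i)) * c (shift i m))" for m
    by (simp add: monomial_split[of x m i] Q_def[symmetric] mult_ac)
  ultimately show ?thesis
    using g'[of "x $ i"] r(1) by (intro that[of "g' (x $ i)"]) (simp_all only: centre_in_ball)
qed

text \<open>
  The coefficients of \<open>\<partial>\<^sub>i \<Sum> c\<^sub>m z\<^sup>m\<close>.
\<close>

definition dcoeff :: "'n \<Rightarrow> (('n \<Rightarrow> nat) \<Rightarrow> complex ^ 'r ^ 'r) \<Rightarrow> ('n \<Rightarrow> nat) \<Rightarrow> complex ^ 'r ^ 'r" where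
  "dcoeff i c m = of_nat (Suc (m i)) *\<^sub>m c (shift i m)"

text \<open>
  The second conclusion has the form of the assumption on \<open>U\<close>, with the same polydisc. This is what allows
  the lemma to be applied to its own result for higher derivatives.
\<close>

lemma power_series_partial_deriv:
  fixes U :: "complex ^ 'n::finite \<Rightarrow> complex ^ 'r ^ 'r"
  assumes U: "\<And>z. z \<in> polydisc R \<Longrightarrow> msums c z (U z)" and x: "x \<in> polydisc R"
  shows "partially_differentiable U i x" "msums (dcoeff i c) x (partial_deriv i U x)"
proof -
  have *: "\<exists>D. ((\<lambda>t. U (set_coord x i t) $ a $ b) has_field_derivative D) (at (x $ i)) \<and>
      ((\<lambda>m. monomial x m * dcoeff i c m $ a $ b) has_sum D) UNIV" for a b
  proof -
    have "((\<lambda>m. monomial z m * c m $ a $ b) has_sum U z $ a $ b) UNIV" if "z \<in> polydisc R" for z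
      using U[OF that] by (simp add: msums_entrywise)
    then obtain D where "((\<lambda>t. U (set_coord x i t) $ a $ b) has_field_derivative D) (at (x $ i))"
      "((\<lambda>m. monomial x m * (of_nat (Suc (m i)) * c (shift i m) $ a $ b)) has_sum D) UNIV"
      using x by (rule power_series_has_partial_derivative)
    thus ?thesis unfolding dcoeff_def mscale_nth by blast
  qed
  show "partially_differentiable U i x"
    using * unfolding partially_differentiable_def field_differentiable_def by blast
  show "msums (dcoeff i c) x (partial_deriv i U x)"
    unfolding msums_entrywise
  proof (intro allI)
    fix a b
    obtain D where D: "((\<lambda>t. U (set_coord x i t) $ a $ b) has_field_derivative D) (at (x $ i))"
        "((\<lambda>m. monomial x m * dcoeff i c m $ a $ b) has_sum D) UNIV"
      using * by blast
    show "((\<lambda>m. monomial x m * dcoeff i c m $ a $ b) has_sum partial_deriv i U x $ a $ b) UNIV"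
      using D(2) by (simp add: partial_deriv_def DERIV_imp_deriv[OF D(1)])
  qed
qed

text \<open>
  The Euler operator \<open>x\<^sub>j \<partial>\<^sub>j\<close> acts diagonally on monomials.
\<close>

lemma msums_euler:
  assumes "msums (dcoeff j c) x S"
  shows "msums (\<lambda>m. of_nat (m j) *\<^sub>m c m) x (x $ j *\<^sub>m S)"
  by (rule msums_coord_mult) (use assms in \<open>simp_all add: dcoeff_def[abs_def]\<close>)

text \<open>
  In the case \<open>i = j\<close> the factor is \<open>m\<^sub>i (m\<^sub>i - 1)\<close>, since \<open>x\<^sub>i\<^sup>2 \<partial>\<^sub>i\<^sup>2\<close> differs from the square of the Euler
  operator by the Euler operator itself.
\<close>

lemma msums_euler2:
  assumes "msums (dcoeff i (dcoeff j c)) x S"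
  shows "msums (\<lambda>m. (of_nat (m i) * (of_nat (m j) - (if i = j then 1 else 0))) *\<^sub>m c m) x
           ((x $ i * x $ j) *\<^sub>m S)"
proof -
  let ?e = "\<lambda>m. (of_nat (m i) * (of_nat (m j) - (if i = j then 1 else 0))) *\<^sub>m c m"
  have "(\<lambda>m. of_nat (m i) *\<^sub>m dcoeff j c m) = (\<lambda>m. ?e (shift j m))"
    by (auto simp: fun_eq_iff dcoeff_def mscale_mscale algebra_simps)
  with msums_euler[OF assms] have "msums (\<lambda>m. ?e (shift j m)) x (x $ i *\<^sub>m S)" by simp
  from msums_coord_mult[OF this] show ?thesis
    by (simp add: mscale_mscale mult.commute)
qed

section \<open>The coefficients of the Lauricella-type series\<close>

definition FA_coeff ::
    "complex ^ 'r ^ 'r \<Rightarrow> ('n::{finite, linorder} \<Rightarrow> complex ^ 'r ^ 'r) \<Rightarrow> ('n \<Rightarrow> complex ^ 'r ^ 'r) \<Rightarrow>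
     ('n \<Rightarrow> nat) \<Rightarrow> complex ^ 'r ^ 'r" where
  "FA_coeff A B C m =
     (1 / (\<Prod>i\<in>UNIV. fact (m i))) *\<^sub>m
       (mpochhammer A (\<Sum>i\<in>UNIV. m i)
         ** ordered_mprod (\<lambda>i. mpochhammer (B i) (m i))
         ** ordered_mprod (\<lambda>i. matrix_inv (mpochhammer (C i) (m i))))"

lemma FA_term_eq: "FA_term A B C x m = monomial x m *\<^sub>m FA_coeff A B C m"
  by (simp add: FA_term_def FA_coeff_def monomial_def mscale_mscale prod_dividef)

text \<open>
  Moving every coordinate of \<open>x\<close> radially outwards by the same small amount gives a point \<open>y\<close> that is still
  in the region. Its moduli strictly exceed those of \<open>x\<close> and serve as radii, because the terms at a point
  of smaller moduli are dominated by those at \<open>y\<close>.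
\<close>

lemma FA_series_on_polydisc:
  assumes "x \<in> interior (FA_abs_conv_region A B C)"
  obtains R where "x \<in> polydisc R"
    and "\<And>z. z \<in> polydisc R \<Longrightarrow> msums (FA_coeff A B C) z (FA A B C z)"
proof -
  obtain e where e: "e > 0" "ball x e \<subseteq> FA_abs_conv_region A B C"
    using assms by (auto simp: mem_interior)
  define \<delta> where "\<delta> = e / (real CARD('a) + 1)"
  have \<delta>: "\<delta> > 0" "real CARD('a) * \<delta> < e"
    using e(1) by (auto simp: \<delta>_def field_simps)
  \<comment> \<open>Unit direction of \<open>x\<^sub>j\<close>; any unit vector serves if \<open>x\<^sub>j = 0\<close>, where the sign function gives 0.\<close>
  define u where "u j = (if x $ j = 0 then 1 else sgn (x $ j))" for j
  have u: "norm (u j) = 1" "x $ j = of_real (norm (x $ j)) * u j" for j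
    by (simp add: u_def norm_sgn) (simp add: u_def sgn_eq)
  define y where "y = (\<chi> j. x $ j + of_real \<delta> * u j)"
  have y_nth: "y $ j = of_real (norm (x $ j) + \<delta>) * u j" for j
    using u(2)[of j] by (simp add: y_def algebra_simps)
  have norm_y: "norm (y $ j) = norm (x $ j) + \<delta>" for j
    using u(1)[of j] \<delta>(1) unfolding y_nth norm_mult norm_of_real by simp
  \<comment> \<open>The 1-norm bounds the Euclidean norm; this fixes the choice of \<open>\<delta>\<close>.\<close>
  have "norm (y - x) \<le> (\<Sum>j\<in>UNIV. norm ((y - x) $ j))"
    unfolding norm_vec_def by (rule L2_set_le_sum) auto
  also have "\<dots> = real CARD('a) * \<delta>"
    using \<delta>(1) u(1) by (simp add: y_def norm_mult)
  finally have "y \<in> ball x e"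
    using \<delta>(2) by (simp add: dist_norm norm_minus_commute)
  hence y: "(\<lambda>m. norm (FA_term A B C y m)) summable_on UNIV"
    using e(2) by (auto simp: FA_abs_conv_region_def)
  show ?thesis
  proof (rule that[of "\<lambda>j. norm (y $ j)"])
    show "x \<in> polydisc (\<lambda>j. norm (y $ j))"
      using \<delta>(1) by (simp add: polydisc_def norm_y)
  next
    fix z assume "z \<in> polydisc (\<lambda>j. norm (y $ j))"
    hence "norm (monomial z m) \<le> norm (monomial y m)" for m
      by (intro norm_monomial_mono) (auto simp: polydisc_def less_imp_le)
    hence "norm (FA_term A B C z m) \<le> norm (FA_term A B C y m)" for m
      by (simp add: FA_term_eq norm_mscale mult_right_mono)
    hence "FA_term A B C z summable_on UNIV"
      by (rule abs_summable_summable[OF Infinite_Sum.abs_summable_on_comparison_test[OF y]])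
    thus "msums (FA_coeff A B C) z (FA A B C z)"
      unfolding msums_def FA_def FA_term_eq[symmetric] by (rule has_sum_infsum)
  qed
qed

text \<open>
  Raising \<open>m\<^sub>i\<close> appends \<open>A + |m| I\<close> to the Pochhammer symbol of \<open>A\<close>, where it may equally stand on the
  left. It appends \<open>X = B\<^sub>i + m\<^sub>i I\<close> to the product of the \<open>B\<close>s and the inverse of \<open>Y = C\<^sub>i + m\<^sub>i I\<close> to the
  product of the \<open>C\<close>s. Multiplying by \<open>Y\<close> cancels the latter, and \<open>X\<close> moves to the right end
  because it commutes with the \<open>C\<close>s and so with their inverses.
\<close>

lemma FA_coeff_recurrence:
  fixes A :: "complex ^ 'r ^ 'r"
    and B C :: "'n::{finite, linorder} \<Rightarrow> complex ^ 'r ^ 'r"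
  assumes C_inv: "\<And>i k. invertible (C i + mat (of_nat k))"
    and BB: "\<And>i j. B i ** B j = B j ** B i"
    and CB: "\<And>i j. C i ** B j = B j ** C i"
    and CC: "\<And>i j. C i ** C j = C j ** C i"
  shows "of_nat (Suc (m i)) *\<^sub>m FA_coeff A B C (shift i m) ** (C i + mat (of_nat (m i))) =
         (A + mat (of_nat (\<Sum>j\<in>UNIV. m j))) ** FA_coeff A B C m ** (B i + mat (of_nat (m i)))"
proof -
  define X where "X = B i + mat (of_nat (m i))"
  define Y where "Y = C i + mat (of_nat (m i))"
  define N where "N = (\<Sum>j\<in>UNIV. m j)"
  define a where "a = mpochhammer A N"
  define b where "b m = ordered_mprod (\<lambda>j. mpochhammer (B j) (m j))" for m
  define c where "c m = ordered_mprod (\<lambda>j. matrix_inv (mpochhammer (C j) (m j)))" for m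
  have inv: "invertible (mpochhammer (C j) k)" for j k
    by (rule invertible_mpochhammer) (rule C_inv)
  have Y_inv: "Y ** matrix_inv Y = mat 1" "matrix_inv Y ** Y = mat 1"
    using matrix_inv_inverse C_inv by (auto simp: Y_def)
  have Y_inv_comm: "commutes (matrix_inv Y) (matrix_inv (mpochhammer (C j) (m j)))" for j
  proof -
    have "commutes Y (mpochhammer (C j) (m j))"
      unfolding Y_def using CC by (intro commutes_shifted commutes_mpochhammer) (simp add: commutes_def)
    hence "commutes (matrix_inv (mpochhammer (C j) (m j))) Y"
      by (rule commutes_sym[OF commutes_matrix_inv[OF inv]])
    with C_inv have "commutes (matrix_inv (mpochhammer (C j) (m j))) (matrix_inv Y)"
      unfolding Y_def by (rule commutes_matrix_inv)
    thus ?thesis by (rule commutes_sym)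
  qed
  have sum: "(\<Sum>j\<in>UNIV. shift i m j) = Suc N"
    by (simp add: N_def sum.remove[of UNIV i])
  have fact: "(\<Prod>j\<in>UNIV. fact (shift i m j)) = of_nat (Suc (m i)) * (\<Prod>j\<in>UNIV. fact (m j) :: complex)"
    by (simp add: prod.remove[of UNIV i] mult.assoc)
  have a: "mpochhammer A (Suc N) = (A + mat (of_nat N)) ** a"
    using commutes_shifted[OF commutes_mpochhammer[of A A N], of "of_nat N"]
    by (simp add: a_def commutes_def)
  have b: "b (shift i m) = b m ** X"
  proof -
    have "commutes X (mpochhammer (B j) (m j))" for j
      unfolding X_def using BB by (intro commutes_shifted commutes_mpochhammer) (simp add: commutes_def)
    from ordered_mprod_upd[of X "\<lambda>j. mpochhammer (B j) (m j)" i, OF this]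
    have "ordered_mprod ((\<lambda>j. mpochhammer (B j) (m j))(i := mpochhammer (B i) (m i) ** X)) = b m ** X"
      by (simp add: b_def)
    moreover have "(\<lambda>j. mpochhammer (B j) (shift i m j)) =
        (\<lambda>j. mpochhammer (B j) (m j))(i := mpochhammer (B i) (m i) ** X)"
      by (auto simp: fun_eq_iff X_def)
    ultimately show ?thesis by (simp add: b_def)
  qed
  have c: "c (shift i m) = c m ** matrix_inv Y"
  proof -
    have "matrix_inv (mpochhammer (C i) (m i) ** Y) ** mpochhammer (C i) (m i) = matrix_inv Y"
      by (rule matrix_inv_mult_cancel) (use inv C_inv in \<open>auto simp: Y_def\<close>)
    hence "matrix_inv (mpochhammer (C i) (m i) ** Y) ** (mpochhammer (C i) (m i)
        ** matrix_inv (mpochhammer (C i) (m i))) = matrix_inv Y ** matrix_inv (mpochhammer (C i) (m i))"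
      by (simp add: matrix_mul_assoc)
    hence "matrix_inv (mpochhammer (C i) (m i) ** Y) = matrix_inv (mpochhammer (C i) (m i)) ** matrix_inv Y"
      using Y_inv_comm[of i] matrix_inv_inverse(1)[OF inv] by (simp add: commutes_def)
    hence "(\<lambda>j. matrix_inv (mpochhammer (C j) (shift i m j))) =
        (\<lambda>j. matrix_inv (mpochhammer (C j) (m j)))(i := matrix_inv (mpochhammer (C i) (m i)) ** matrix_inv Y)"
      by (auto simp: fun_eq_iff Y_def)
    thus ?thesis
      unfolding c_def
      using ordered_mprod_upd[of "matrix_inv Y" "\<lambda>j. matrix_inv (mpochhammer (C j) (m j))" i]
      by (simp only: Y_inv_comm simp_thms)
  qed
  have Xc: "X ** c m = c m ** X"
  proof -
    have "commutes (B i) (mpochhammer (C j) (m j))" for j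
      using CB by (intro commutes_mpochhammer) (simp add: commutes_def)
    hence "commutes X (c m)"
      unfolding X_def c_def using inv
      by (intro commutes_shifted commutes_ordered_mprod commutes_matrix_inv)
    thus ?thesis by (simp add: commutes_def)
  qed
  have "mpochhammer A (Suc N) ** b (shift i m) ** c (shift i m) ** Y
      = (A + mat (of_nat N)) ** a ** b m ** (X ** c m) ** (matrix_inv Y ** Y)"
    unfolding a b c by (simp only: matrix_mul_assoc)
  also have "\<dots> = (A + mat (of_nat N)) ** (a ** b m ** c m) ** X"
    unfolding Xc Y_inv by (simp add: matrix_mul_assoc)
  finally have main: "mpochhammer A (Suc N) ** b (shift i m) ** c (shift i m) ** Y
      = (A + mat (of_nat N)) ** (a ** b m ** c m) ** X" .
  have "complex_of_nat (Suc (m i)) \<noteq> 0" by (rule of_nat_neq_0)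
  thus ?thesis
    unfolding FA_coeff_def sum fact b_def[symmetric] c_def[symmetric] X_def[symmetric]
      Y_def[symmetric] N_def[symmetric] a_def[symmetric]
    by (simp add: mscale_mult_left mscale_mult_right mscale_mscale main
        del: of_nat_Suc fun_upd_apply mpochhammer.simps)
qed

section \<open>The system of differential equations\<close>

text \<open>
  With \<open>\<mu> = m\<^sub>i\<close>, \<open>N = |m|\<close>, \<open>K = K(m)\<close> and \<open>E\<close> the coefficient at \<open>m + e\<^sub>i\<close>, the conclusion is the
  coefficient of \<open>x\<^sup>m\<close> in the differential equation: the terms in \<open>E\<close> add up to the left-hand side of the
  recurrence and those in \<open>K\<close> to minus its right-hand side, where the \<open>- 1\<close> from the quadratic part cancels against the identity
  matrix in \<open>A + I\<close>.
\<close>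

lemma coefficient_identity:
  fixes A B C K E :: "complex ^ 'r ^ 'r"
  assumes rec: "(\<mu> + 1) *\<^sub>m E ** (C + mat \<mu>) = (A + mat N) ** K ** (B + mat \<mu>)"
  shows "\<mu> *\<^sub>m (\<mu> + 1) *\<^sub>m E - (\<mu> * (N - 1)) *\<^sub>m K - (A + mat 1) ** (\<mu> *\<^sub>m K)
           - (N *\<^sub>m K) ** B + ((\<mu> + 1) *\<^sub>m E) ** C - A ** K ** B = 0"
  using rec
  by (simp add: matrix_add_ldistrib matrix_add_rdistrib mat_mult_left mat_mult_right
      mscale_mult_left mscale_mult_right vec_eq_iff algebra_simps)

theorem theorem3p1:
  fixes A :: "complex ^ 'r ^ 'r"
    and B C :: "'n::{finite, linorder} \<Rightarrow> complex ^ 'r ^ 'r"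
  assumes C_inv: "\<And>i k. invertible (C i + mat (of_nat k))"
    and BB: "\<And>i j. B i ** B j = B j ** B i"
    and CB: "\<And>i j. C i ** B j = B j ** C i"
    and CC: "\<And>i j. C i ** C j = C j ** C i"
  shows "let U = FA A B C in
    \<forall>x \<in> interior (FA_abs_conv_region A B C).
      (\<forall>i. partially_differentiable U i x) \<and>
      (\<forall>i j. partially_differentiable (partial_deriv j U) i x) \<and>
      (\<forall>i. (x $ i * (1 - x $ i)) *\<^sub>m partial_deriv2 i i U x
           - (\<Sum>j\<in>UNIV - {i}. (x $ i * x $ j) *\<^sub>m partial_deriv2 i j U x)
           - x $ i *\<^sub>m ((A + mat 1) ** partial_deriv i U x)
           - (\<Sum>j\<in>UNIV. x $ j *\<^sub>m partial_deriv j U x) ** B i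
           + partial_deriv i U x ** C i
           - A ** U x ** B i = 0)"
  unfolding Let_def
proof (rule ballI)
  fix x assume "x \<in> interior (FA_abs_conv_region A B C)"
  then obtain R where x: "x \<in> polydisc R"
    and U: "\<And>z. z \<in> polydisc R \<Longrightarrow> msums (FA_coeff A B C) z (FA A B C z)"
    using FA_series_on_polydisc by blast
  define U where "U = FA A B C"
  define K where "K = FA_coeff A B C"
  note U' = U[folded U_def K_def]
  have U0: "msums K x (U x)"
    using U'[OF x] .
  have dU: "msums (dcoeff j K) z (partial_deriv j U z)" if "z \<in> polydisc R" for j z
    by (rule power_series_partial_deriv(2)[OF U' that])
  have ddU: "msums (dcoeff i (dcoeff j K)) x (partial_deriv2 i j U x)" for i j
    unfolding partial_deriv2_def by (rule power_series_partial_deriv(2)[OF dU x])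
  have pde: "(x $ i * (1 - x $ i)) *\<^sub>m partial_deriv2 i i U x
           - (\<Sum>j\<in>UNIV - {i}. (x $ i * x $ j) *\<^sub>m partial_deriv2 i j U x)
           - x $ i *\<^sub>m ((A + mat 1) ** partial_deriv i U x)
           - (\<Sum>j\<in>UNIV. x $ j *\<^sub>m partial_deriv j U x) ** B i
           + partial_deriv i U x ** C i
           - A ** U x ** B i = 0" (is "?lhs = 0") for i
  proof -
    define N where "N m = (\<Sum>j\<in>UNIV. complex_of_nat (m j))" for m :: "'n \<Rightarrow> nat"
    have "msums (\<lambda>m. \<Sum>j\<in>UNIV. (of_nat (m i) * (of_nat (m j) - (if i = j then 1 else 0))) *\<^sub>m K m) x
        (\<Sum>j\<in>UNIV. (x $ i * x $ j) *\<^sub>m partial_deriv2 i j U x)"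
      by (intro msums_sum msums_euler2 ddU) simp
    moreover have "(\<Sum>j\<in>UNIV. (of_nat (m i) * (of_nat (m j) - (if i = j then 1 else 0))) *\<^sub>m K m)
        = (of_nat (m i) * (N m - 1)) *\<^sub>m K m" for m
      by (simp add: mscale_sum_left[symmetric] sum_distrib_left[symmetric] sum_subtractf N_def)
    ultimately have quad: "msums (\<lambda>m. (of_nat (m i) * (N m - 1)) *\<^sub>m K m) x
        (\<Sum>j\<in>UNIV. (x $ i * x $ j) *\<^sub>m partial_deriv2 i j U x)"
      by simp
    have "msums (\<lambda>m. \<Sum>j\<in>UNIV. of_nat (m j) *\<^sub>m K m) x (\<Sum>j\<in>UNIV. x $ j *\<^sub>m partial_deriv j U x)"
      by (intro msums_sum msums_euler dU x) simp
    hence euler: "msums (\<lambda>m. N m *\<^sub>m K m) x (\<Sum>j\<in>UNIV. x $ j *\<^sub>m partial_deriv j U x)"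
      by (simp add: mscale_sum_left N_def)
    have lead: "msums (\<lambda>m. of_nat (m i) *\<^sub>m dcoeff i K m) x (x $ i *\<^sub>m partial_deriv2 i i U x)"
      by (rule msums_euler[OF ddU])
    \<comment> \<open>The summand \<open>- x\<^sub>i\<^sup>2 U\<^sub>i\<^sub>i\<close> of the leading term fills the gap \<open>j = i\<close> in the sum of mixed derivatives.\<close>
    have "?lhs = x $ i *\<^sub>m partial_deriv2 i i U x
           - (\<Sum>j\<in>UNIV. (x $ i * x $ j) *\<^sub>m partial_deriv2 i j U x)
           - (A + mat 1) ** (x $ i *\<^sub>m partial_deriv i U x)
           - (\<Sum>j\<in>UNIV. x $ j *\<^sub>m partial_deriv j U x) ** B i
           + partial_deriv i U x ** C i
           - A ** U x ** B i" (is "_ = ?rhs")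
      by (simp add: sum.remove[of UNIV i "\<lambda>j. (x $ i * x $ j) *\<^sub>m partial_deriv2 i j U x"]
          mscale_mult_right) (simp add: vec_eq_iff algebra_simps)
    also have "\<dots> = 0"
    proof (rule msums_unique)
      show "msums (\<lambda>m. of_nat (m i) *\<^sub>m dcoeff i K m - (of_nat (m i) * (N m - 1)) *\<^sub>m K m
          - (A + mat 1) ** (of_nat (m i) *\<^sub>m K m) - (N m *\<^sub>m K m) ** B i
          + dcoeff i K m ** C i - A ** K m ** B i) x ?rhs"
        by (intro msums_add msums_diff msums_mult_left msums_mult_right lead quad euler
            msums_euler dU[OF x] U0)
      have "of_nat (m i) *\<^sub>m dcoeff i K m - (of_nat (m i) * (N m - 1)) *\<^sub>m K m
          - (A + mat 1) ** (of_nat (m i) *\<^sub>m K m) - (N m *\<^sub>m K m) ** B i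
          + dcoeff i K m ** C i - A ** K m ** B i = 0" for m
        using coefficient_identity[of "of_nat (m i)" "K (shift i m)" "C i" A "N m" "K m" "B i"]
          FA_coeff_recurrence[of C B m i A, OF C_inv BB CB CC]
        by (simp add: dcoeff_def K_def N_def add.commute)
      thus "msums (\<lambda>m. of_nat (m i) *\<^sub>m dcoeff i K m - (of_nat (m i) * (N m - 1)) *\<^sub>m K m
          - (A + mat 1) ** (of_nat (m i) *\<^sub>m K m) - (N m *\<^sub>m K m) ** B i
          + dcoeff i K m ** C i - A ** K m ** B i) x 0"
        by (simp add: msums_zero)
    qed
    finally show ?thesis .
  qed
  have diff: "partially_differentiable U i x" for i
    by (rule power_series_partial_deriv(1)[OF U' x])
  have diff2: "partially_differentiable (partial_deriv j U) i x" for i j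
    by (rule power_series_partial_deriv(1)[OF dU x])
  show "(\<forall>i. partially_differentiable (FA A B C) i x) \<and>
      (\<forall>i j. partially_differentiable (partial_deriv j (FA A B C)) i x) \<and>
      (\<forall>i. (x $ i * (1 - x $ i)) *\<^sub>m partial_deriv2 i i (FA A B C) x
           - (\<Sum>j\<in>UNIV - {i}. (x $ i * x $ j) *\<^sub>m partial_deriv2 i j (FA A B C) x)
           - x $ i *\<^sub>m ((A + mat 1) ** partial_deriv i (FA A B C) x)
           - (\<Sum>j\<in>UNIV. x $ j *\<^sub>m partial_deriv j (FA A B C) x) ** B i
           + partial_deriv i (FA A B C) x ** C i
           - A ** FA A B C x ** B i = 0)"
    unfolding U_def[symmetric] by (intro conjI allI diff diff2 pde)
qed

end
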